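(* For every integer $d\ge3$, for the model $\mathcal{I}_{n,d}$ the smallest order of a supercritical tangle is $\tau_{\mathrm{fund}}=\lceil\sqrt{d-1}\rceil-1$.
   Context: $\mathcal{I}_{n,d}$ ($n$ even): $d$ independent uniformly random perfect matchings (fixed-point-free involutions) $\sigma_1,\dots,\sigma_d$ of $\{1,\dots,n\}$; the graph on $\{1,\dots,n\}$ has an undirected edge $\{i,\sigma_j(i)\}$ labelled $\sigma_j$ (in both directions) for each $j$ and each pair matched by $\sigma_j$. A tangle is a connected labelled graph that occurs (via a label-preserving homomorphism injective on vertices and edges) in some graph of $\mathcal{I}_{n,d}$ for some $n$. The order of a graph is (number of undirected edges) $-$ (number of vertices). For a graph $T$, $T_{\mathrm{irr}}$ is the directed graph on the directed edges of $T$ with $e_1\to e_2$ iff $e_1$ terminates at the origin of $e_2$ and $e_2$ is not the reverse of $e_1$; $\lambda_{\mathrm{irr}}(T)$ is the Perron–Frobenius eigenvalue of $T_{\mathrm{irr}}$. A tangle is supercritical if $\lambda_{\mathrm{irr}}\ge\sqrt{d-1}$. *)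

theory Defs
  imports
    Complex_Main
    "HOL-Combinatorics.Permutations"
    "Graph_Theory.Digraph_Component"
    "Graph_Theory.Bidirected_Digraph"
    "Jordan_Normal_Form.Char_Poly"
begin

text \<open>
  An undirected edge is a pair of mutually reverse arcs, so that the arcs are the directed edges
  and parallel edges (which do occur when two matchings share a pair) are kept apart.
\<close>

record ('v, 'e) lgraph =
  dgraph :: "('v, 'e) pre_digraph"
  rev_arc :: "'e \<Rightarrow> 'e"
  arc_label :: "'e \<Rightarrow> nat"

definition labelled_graph :: "('v, 'e) lgraph \<Rightarrow> bool" where
  "labelled_graph T \<longleftrightarrow>
     fin_digraph (dgraph T) \<and>
     bidirected_digraph (dgraph T) (rev_arc T) \<and>
     (\<forall>a \<in> arcs (dgraph T). arc_label T (rev_arc T a) = arc_label T a)"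

definition undirected_edges :: "('v, 'e) lgraph \<Rightarrow> 'e set set" where
  "undirected_edges T = (\<lambda>a. {a, rev_arc T a}) ` arcs (dgraph T)"

definition graph_order :: "('v, 'e) lgraph \<Rightarrow> int" where
  "graph_order T = int (card (undirected_edges T)) - int (card (verts (dgraph T)))"

definition perfect_matchings :: "nat \<Rightarrow> (nat \<Rightarrow> nat) set" where
  "perfect_matchings n =
     {\<sigma>. \<sigma> permutes {1..n} \<and> (\<forall>i \<in> {1..n}. \<sigma> (\<sigma> i) = i \<and> \<sigma> i \<noteq> i)}"

text \<open>
  The arc \<open>(i, j)\<close> runs from \<open>i\<close> to \<open>\<sigma> j i\<close> and is labelled \<open>j\<close>. The reversal is the identity
  off the arc set, as the locale \<open>bidirected_digraph\<close> requires.
\<close>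

definition matching_graph :: "nat \<Rightarrow> nat \<Rightarrow> (nat \<Rightarrow> nat \<Rightarrow> nat) \<Rightarrow> (nat, nat \<times> nat) lgraph" where
  "matching_graph n d \<sigma> =
     \<lparr> dgraph =
         \<lparr> verts = {1..n}, arcs = {1..n} \<times> {1..d}, tail = fst, head = (\<lambda>(i, j). \<sigma> j i) \<rparr>,
       rev_arc = (\<lambda>(i, j). if (i, j) \<in> {1..n} \<times> {1..d} then (\<sigma> j i, j) else (i, j)),
       arc_label = snd \<rparr>"

text \<open>
  The possible outcomes of the random graph. The matchings are independent and uniform, so every
  choice of \<open>d\<close> perfect matchings has positive probability.
\<close>

definition model_graphs :: "nat \<Rightarrow> nat \<Rightarrow> (nat, nat \<times> nat) lgraph set" where
  "model_graphs n d = {matching_graph n d \<sigma> | \<sigma>. \<forall>j \<in> {1..d}. \<sigma> j \<in> perfect_matchings n}"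

definition label_embedding ::
  "('v, 'e) lgraph \<Rightarrow> ('w, 'f) lgraph \<Rightarrow> ('v \<Rightarrow> 'w) \<Rightarrow> ('e \<Rightarrow> 'f) \<Rightarrow> bool" where
  "label_embedding T G fv fe \<longleftrightarrow>
     fv ` verts (dgraph T) \<subseteq> verts (dgraph G) \<and> inj_on fv (verts (dgraph T)) \<and>
     fe ` arcs (dgraph T) \<subseteq> arcs (dgraph G) \<and> inj_on fe (arcs (dgraph T)) \<and>
     (\<forall>a \<in> arcs (dgraph T).
        tail (dgraph G) (fe a) = fv (tail (dgraph T) a) \<and>
        head (dgraph G) (fe a) = fv (head (dgraph T) a) \<and>
        rev_arc G (fe a) = fe (rev_arc T a) \<and>
        arc_label G (fe a) = arc_label T a)"

definition tangle :: "nat \<Rightarrow> ('v, 'e) lgraph \<Rightarrow> bool" where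
  "tangle d T \<longleftrightarrow>
     labelled_graph T \<and> Digraph_Component.connected (dgraph T) \<and>
     (\<exists>n. even n \<and> (\<exists>G \<in> model_graphs n d. \<exists>fv fe. label_embedding T G fv fe))"

definition irr_graph :: "('v, 'e) lgraph \<Rightarrow> ('e, 'e \<times> 'e) pre_digraph" where
  "irr_graph T =
     \<lparr> verts = arcs (dgraph T),
       arcs = {(a, b). a \<in> arcs (dgraph T) \<and> b \<in> arcs (dgraph T) \<and>
                 head (dgraph T) a = tail (dgraph T) b \<and> b \<noteq> rev_arc T a},
       tail = fst, head = snd \<rparr>"

definition adjacency_mat :: "('v, 'e) pre_digraph \<Rightarrow> 'v list \<Rightarrow> complex mat" where
  "adjacency_mat D vs = mat (length vs) (length vs)
     (\<lambda>(i, j). of_nat (card {a \<in> arcs D. tail D a = vs ! i \<and> head D a = vs ! j}))"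

text \<open>
  The Perron--Frobenius eigenvalue of a finite digraph: the nonnegative real eigenvalue of the
  adjacency matrix that is at least the modulus of every eigenvalue. The spectrum does not depend
  on the enumeration \<open>vs\<close> of the vertices. Such an \<open>r\<close> is unique, and by the Perron--Frobenius
  theorem it exists unless the digraph has no vertices (for an \<open>irr_graph\<close>: unless the underlying
  graph has no edges), where there are no eigenvalues at all. An edgeless graph is thus not
  supercritical.
\<close>

definition perron_frobenius_eigenvalue :: "('v, 'e) pre_digraph \<Rightarrow> real \<Rightarrow> bool" where
  "perron_frobenius_eigenvalue D r \<longleftrightarrow>
     (\<exists>vs. distinct vs \<and> set vs = verts D \<and> 0 \<le> r \<and>
        eigenvalue (adjacency_mat D vs) (complex_of_real r) \<and>
        (\<forall>z. eigenvalue (adjacency_mat D vs) z \<longrightarrow> cmod z \<le> r))"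

definition supercritical :: "nat \<Rightarrow> ('v, 'e) lgraph \<Rightarrow> bool" where
  "supercritical d T \<longleftrightarrow>
     (\<exists>r. perron_frobenius_eigenvalue (irr_graph T) r \<and> sqrt (real d - 1) \<le> r)"

end

theory Submission
  imports Defs
begin

text \<open>
  Let \<open>k\<close> be the order of a connected loopless graph. Removing a leaf with its edge changes neither
  \<open>k\<close> nor the nonzero non-backtracking eigenvalues, so all degrees may be taken to be at least 2.
  As \<open>(deg u - 2)\<close> sums to \<open>2 k\<close> over all vertices, adjacent vertices \<open>v \<noteq> w\<close> satisfy
  \<open>(deg v - 1) + (deg w - 1) \<le> 2 k + 2\<close>. Counting non-backtracking walks of length two gives
  \<open>\<lambda>\<^sup>2 \<le> max (deg v - 1) (deg w - 1) \<le> (k + 1)\<^sup>2\<close>, so \<open>\<lambda> \<ge> sqrt (d - 1)\<close> forces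
  \<open>k + 1 \<ge> \<lceil>sqrt (d - 1)\<rceil>\<close>. Two vertices joined by \<open>\<lceil>sqrt (d - 1)\<rceil> + 1\<close> parallel edges attain
  equality.
\<close>

section \<open>Eigenvalues as solutions of functional equations\<close>

text \<open>Replaces vectors indexed by positions in \<open>vs\<close> with functions on the
  vertices, so that the enumeration disappears from all later arguments.\<close>

lemma eigenvalue_adjacency_mat_iff:
  assumes vs: "distinct vs" "set vs = verts D"
  shows "eigenvalue (adjacency_mat D vs) z \<longleftrightarrow>
    (\<exists>f. (\<exists>a\<in>verts D. f a \<noteq> 0) \<and>
      (\<forall>a\<in>verts D. z * f a =
        (\<Sum>b\<in>verts D. of_nat (card {e \<in> arcs D. tail D e = a \<and> head D e = b}) * f b)))"
    (is "?L \<longleftrightarrow> (\<exists>f. ?nz f \<and> ?eq f)")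
proof -
  define n where "n = length vs"
  define N where "N a b = (of_nat (card {e \<in> arcs D. tail D e = a \<and> head D e = b}) :: complex)"
    for a b
  have mult: "(adjacency_mat D vs *\<^sub>v v) $ i = (\<Sum>j<n. N (vs ! i) (vs ! j) * v $ j)"
    if "v \<in> carrier_vec n" "i < n" for v i
    using that by (simp add: adjacency_mat_def n_def N_def scalar_prod_def atLeast0LessThan)
  have bij: "bij_betw ((!) vs) {..<n} (verts D)"
    using vs by (simp add: bij_betw_nth n_def)
  have sum_vs: "(\<Sum>b\<in>verts D. g b) = (\<Sum>j<n. g (vs ! j))" for g :: "'a \<Rightarrow> complex"
    by (rule sum.reindex_bij_betw[OF bij, symmetric])
  have all_vs: "(\<forall>a\<in>verts D. P a) \<longleftrightarrow> (\<forall>i<n. P (vs ! i))" for P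
    using vs by (metis in_set_conv_nth n_def)
  have ex_vs: "(\<exists>a\<in>verts D. P a) \<longleftrightarrow> (\<exists>i<n. P (vs ! i))" for P
    using vs by (metis in_set_conv_nth n_def)
  have dim: "dim_row (adjacency_mat D vs) = n"
    by (simp add: adjacency_mat_def n_def)
  have ev: "eigenvector (adjacency_mat D vs) v z \<longleftrightarrow> v \<in> carrier_vec n \<and> (\<exists>i<n. v $ i \<noteq> 0) \<and>
      (\<forall>i<n. z * v $ i = (\<Sum>j<n. N (vs ! i) (vs ! j) * v $ j))" for v
  proof (cases "v \<in> carrier_vec n")
    case True
    have "v \<noteq> 0\<^sub>v n \<longleftrightarrow> (\<exists>i<n. v $ i \<noteq> 0)"
      using True by (auto simp: vec_eq_iff)
    moreover have "adjacency_mat D vs *\<^sub>v v = z \<cdot>\<^sub>v v \<longleftrightarrow>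
        (\<forall>i<n. z * v $ i = (\<Sum>j<n. N (vs ! i) (vs ! j) * v $ j))"
    proof -
      have "adjacency_mat D vs *\<^sub>v v = z \<cdot>\<^sub>v v \<longleftrightarrow>
          (\<forall>i<n. z * v $ i = (adjacency_mat D vs *\<^sub>v v) $ i)"
        using True dim by (auto simp: vec_eq_iff)
      then show ?thesis
        using True by (simp add: mult)
    qed
    ultimately show ?thesis
      using True by (simp add: eigenvector_def dim)
  qed (simp add: eigenvector_def dim)
  show ?thesis
  proof
    assume ?L
    then obtain v where v: "eigenvector (adjacency_mat D vs) v z"
      by (auto simp: eigenvalue_def)
    define f where "f = (\<lambda>a. v $ the_inv_into {..<n} ((!) vs) a)"
    have f: "f (vs ! i) = v $ i" if "i < n" for i
      using that bij by (simp add: f_def bij_betw_def the_inv_into_f_f)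
    have "?nz f \<and> ?eq f"
      using v unfolding ev all_vs ex_vs sum_vs N_def[symmetric] by (auto simp: f)
    then show "\<exists>f. ?nz f \<and> ?eq f"
      by (rule exI[of _ f])
  next
    assume "\<exists>f. ?nz f \<and> ?eq f"
    then obtain f where f: "?nz f" "?eq f"
      by auto
    have "eigenvector (adjacency_mat D vs) (vec n (\<lambda>i. f (vs ! i))) z"
      using f unfolding ev all_vs ex_vs sum_vs N_def[symmetric] by auto
    then show ?L
      by (auto simp: eigenvalue_def)
  qed
qed

definition nb_succ :: "('v, 'e) pre_digraph \<Rightarrow> ('e \<Rightarrow> 'e) \<Rightarrow> 'e set \<Rightarrow> 'e \<Rightarrow> 'e set" where
  "nb_succ G r C a = {b \<in> C. tail G b = head G a \<and> b \<noteq> r a}"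

text \<open>A right eigenvector of the non-backtracking (Hashimoto) operator restricted to the arcs
  in \<open>C\<close>. Keeping \<open>C\<close> apart from \<open>G\<close> lets pruning shrink the
  arc set while \<open>G\<close> and \<open>f\<close> stay fixed; values of \<open>f\<close> off
  \<open>C\<close> are unconstrained.\<close>

definition nb_eigenfun ::
  "('v, 'e) pre_digraph \<Rightarrow> ('e \<Rightarrow> 'e) \<Rightarrow> 'e set \<Rightarrow> complex \<Rightarrow> ('e \<Rightarrow> complex) \<Rightarrow> bool" where
  "nb_eigenfun G r C z f \<longleftrightarrow>
     (\<exists>a\<in>C. f a \<noteq> 0) \<and> (\<forall>a\<in>C. z * f a = (\<Sum>b\<in>nb_succ G r C a. f b))"

text \<open>The arcs of \<open>irr_graph T\<close> are themselves pairs, so the adjacency matrix has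
  entries 0 and 1 and each row sum runs over the successors of an arc.\<close>

lemma eigenvalue_irr_graph_iff:
  assumes fin: "finite (arcs (dgraph T))"
    and vs: "distinct vs" "set vs = arcs (dgraph T)"
  shows "eigenvalue (adjacency_mat (irr_graph T) vs) z \<longleftrightarrow>
    (\<exists>f. nb_eigenfun (dgraph T) (rev_arc T) (arcs (dgraph T)) z f)"
proof -
  let ?A = "arcs (dgraph T)" and ?S = "nb_succ (dgraph T) (rev_arc T) (arcs (dgraph T))"
  have verts: "verts (irr_graph T) = ?A"
    by (simp add: irr_graph_def)
  have "{e \<in> arcs (irr_graph T). tail (irr_graph T) e = a \<and> head (irr_graph T) e = b} =
      (if b \<in> ?S a then {(a, b)} else {})" if "a \<in> ?A" "b \<in> ?A" for a b
    using that by (auto simp: irr_graph_def nb_succ_def)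
  then have "(\<Sum>b\<in>?A. of_nat (card {e \<in> arcs (irr_graph T). tail (irr_graph T) e = a \<and>
        head (irr_graph T) e = b}) * f b) = (\<Sum>b\<in>?A. if b \<in> ?S a then f b else 0)"
    if "a \<in> ?A" for a and f :: "_ \<Rightarrow> complex"
    using that by (intro sum.cong) auto
  moreover have "(\<Sum>b\<in>?A. if b \<in> ?S a then f b else 0) = (\<Sum>b\<in>?S a. f b)"
    for a and f :: "_ \<Rightarrow> complex"
    using fin by (intro sum.mono_neutral_cong_right) (auto simp: nb_succ_def)
  ultimately show ?thesis
    using vs by (simp add: eigenvalue_adjacency_mat_iff verts nb_eigenfun_def cong: ball_cong)
qed

text \<open>Maximum principle: evaluate the equation at an arc where \<open>cmod (f a)\<close> is
  largest. It later shows that the eigenvalue found for the extremal graph dominates the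
  spectrum.\<close>

lemma nb_eigenfun_cmod_le:
  assumes fin: "finite C" and f: "nb_eigenfun G r C z f"
    and deg: "\<And>a. a \<in> C \<Longrightarrow> card (nb_succ G r C a) \<le> m"
  shows "cmod z \<le> m"
proof -
  obtain a0 where a0: "a0 \<in> C" "f a0 \<noteq> 0"
    using f by (auto simp: nb_eigenfun_def)
  have "Max ((\<lambda>b. cmod (f b)) ` C) \<in> (\<lambda>b. cmod (f b)) ` C"
    using fin a0 by (intro Max_in) auto
  then obtain a where "a \<in> C" "Max ((\<lambda>b. cmod (f b)) ` C) = cmod (f a)"
    by auto
  then have a: "a \<in> C" "\<And>b. b \<in> C \<Longrightarrow> cmod (f b) \<le> cmod (f a)"
    using fin by (auto simp flip: \<open>_ = cmod (f a)\<close>)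
  have "cmod z * cmod (f a) = cmod (\<Sum>b\<in>nb_succ G r C a. f b)"
    using f a by (metis nb_eigenfun_def norm_mult)
  also have "\<dots> \<le> of_nat (card (nb_succ G r C a)) * cmod (f a)"
    using a by (intro sum_norm_bound) (auto simp: nb_succ_def)
  also have "\<dots> \<le> of_nat m * cmod (f a)"
    using deg a by (intro mult_right_mono) auto
  finally have "cmod z * cmod (f a) \<le> real m * cmod (f a)" .
  moreover have "cmod (f a) > 0"
    using a(2)[OF a0(1)] a0(2) by (smt (verit) zero_less_norm_iff)
  ultimately show ?thesis
    by simp
qed

section \<open>Order and non-backtracking spectrum of bidirected multigraphs\<close>

locale fin_bidirected_digraph = fin_digraph G + bidirected_digraph G arev for G arev
begin

text \<open>Needed to upgrade the connectedness of a tangle to strong connectedness.\<close>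

lemma symmetric: "symmetric G"
  unfolding symmetric_def arcs_ends_conv
proof (rule symI)
  fix x y
  assume "(x, y) \<in> (\<lambda>e. (tail G e, head G e)) ` arcs G"
  then obtain a where "a \<in> arcs G" "x = tail G a" "y = head G a"
    by auto
  then show "(y, x) \<in> (\<lambda>e. (tail G e, head G e)) ` arcs G"
    by (intro image_eqI[of _ _ "arev a"]) auto
qed

text \<open>\<open>arev\<close> is an involution without fixed points on the arcs, so its orbits
  partition them into pairs.\<close>

lemma card_arcs: "card (arcs G) = 2 * card ((\<lambda>a. {a, arev a}) ` arcs G)"
proof -
  have "2 * card ((\<lambda>a. {a, arev a}) ` arcs G) = card (\<Union> ((\<lambda>a. {a, arev a}) ` arcs G))"
  proof (rule card_partition)
    fix c
    assume "c \<in> (\<lambda>a. {a, arev a}) ` arcs G"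
    then show "card c = 2"
      by (auto simp: card_2_iff dest: arev_neq)
  next
    fix c1 c2
    assume "c1 \<in> (\<lambda>a. {a, arev a}) ` arcs G" "c2 \<in> (\<lambda>a. {a, arev a}) ` arcs G" "c1 \<noteq> c2"
    then show "c1 \<inter> c2 = {}"
      by (auto simp: doubleton_eq_iff dest: arg_cong[of _ _ arev])
  qed auto
  also have "\<Union> ((\<lambda>a. {a, arev a}) ` arcs G) = arcs G"
    by auto
  finally show ?thesis ..
qed

text \<open>The subgraph \<open>(W, C)\<close> has order at most that of \<open>G\<close>: growing
  it to all of \<open>G\<close> one vertex at a time, each new vertex brings at least one new edge,
  that is, two arcs.\<close>

lemma card_verts_diff_le:
  assumes conn: "strongly_connected G"
    and "W \<subseteq> verts G" "W \<noteq> {}" "C \<subseteq> arcs G" "arev ` C \<subseteq> C" "tail G ` C \<subseteq> W"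
  shows "2 * card (verts G - W) \<le> card (arcs G - C)"
  using assms(2-)
proof (induction "card (verts G - W)" arbitrary: W C)
  case (Suc n)
  obtain u where u: "u \<in> W"
    using Suc.prems by auto
  obtain v where v: "v \<in> verts G" "v \<notin> W"
    using Suc.hyps(2) by (cases "verts G - W = {}") auto
  have "u \<rightarrow>\<^sup>*\<^bsub>G\<^esub> v"
    using conn u v Suc.prems(1) by (auto simp: strongly_connected_def)
  \<comment> \<open>A walk from inside \<open>W\<close> to a vertex outside must cross the boundary
    somewhere.\<close>
  then have "\<exists>a\<in>arcs G. tail G a \<in> W \<and> head G a \<notin> W"
    using u v(2)
  proof (induction rule: converse_reachable_induct)
    case (step x y)
    then show ?case
      by (cases "y \<in> W") (auto simp: arcs_ends_conv)
  qed simp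
  then obtain a where a: "a \<in> arcs G" "tail G a \<in> W" "head G a \<notin> W"
    by auto
  \<comment> \<open>\<open>arev a\<close> starts outside \<open>W\<close>, whereas every arc of
    \<open>C\<close> starts inside; closure under \<open>arev\<close> then excludes \<open>a\<close>
    as well.\<close>
  have "arev a \<notin> C"
    using Suc.prems(5) a tail_arev[OF a(1)] by (auto simp: image_subset_iff)
  moreover from this have "a \<notin> C"
    using Suc.prems(4) by auto
  ultimately have new: "a \<notin> C" "arev a \<notin> C"
    by auto
  let ?W = "insert (head G a) W" and ?C = "C \<union> {a, arev a}"
  have "verts G - W = insert (head G a) (verts G - ?W)"
    using a by auto
  also have "card \<dots> = Suc (card (verts G - ?W))"
    by (rule card_insert_disjoint) auto
  finally have W: "card (verts G - W) = Suc (card (verts G - ?W))" .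
  have "arcs G - C = insert a (insert (arev a) (arcs G - ?C))"
    using a new by auto
  also have "card \<dots> = Suc (card (insert (arev a) (arcs G - ?C)))"
    using arev_neq[OF a(1)] by (intro card_insert_disjoint) auto
  also have "card (insert (arev a) (arcs G - ?C)) = Suc (card (arcs G - ?C))"
    by (rule card_insert_disjoint) auto
  finally have C: "card (arcs G - C) = Suc (Suc (card (arcs G - ?C)))" .
  have "2 * card (verts G - ?W) \<le> card (arcs G - ?C)"
  proof (rule Suc.hyps(1))
    show "n = card (verts G - ?W)"
      using Suc.hyps(2) W by simp
  qed (use Suc.prems a in auto)
  then show ?case
    using W C by simp
qed simp

text \<open>
  A leaf arc \<open>a\<close> makes \<open>f (arev a) = 0\<close>, as \<open>arev a\<close> has no successor, so deleting both arcs keeps an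
  eigenfunction.
\<close>

lemma nb_eigenfun_pruned:
  assumes f: "nb_eigenfun G arev (arcs G) z f" and z: "z \<noteq> 0"
    and loopless: "\<And>a. a \<in> arcs G \<Longrightarrow> head G a \<noteq> tail G a"
  obtains C where "C \<subseteq> arcs G" "arev ` C \<subseteq> C" "nb_eigenfun G arev C z f"
    "\<And>a. a \<in> C \<Longrightarrow> nb_succ G arev C a \<noteq> {}"
proof -
  define P where "P C \<longleftrightarrow> C \<subseteq> arcs G \<and> arev ` C \<subseteq> C \<and> nb_eigenfun G arev C z f" for C
  have "P (arcs G)"
    using f by (auto simp: P_def)
  \<comment> \<open>A set of least cardinality replaces the iterated removal of leaves.\<close>
  then obtain C where C: "P C" and min: "\<And>B. P B \<Longrightarrow> card C \<le> card B"
    using ex_has_least_nat[of P "arcs G" card] by blast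
  have sub: "C \<subseteq> arcs G" and rev: "\<And>a. a \<in> C \<Longrightarrow> arev a \<in> C"
    and eq: "\<And>a. a \<in> C \<Longrightarrow> z * f a = (\<Sum>b\<in>nb_succ G arev C a. f b)"
    using C by (auto simp: P_def nb_eigenfun_def)
  have fin: "finite C"
    using sub finite_arcs by (rule finite_subset)
  have "nb_succ G arev C a \<noteq> {}" if a: "a \<in> C" for a
  proof
    assume emp: "nb_succ G arev C a = {}"
    let ?B = "C - {a, arev a}"
    \<comment> \<open>Here \<open>a\<close> is the arc pointing into the leaf, the one without
      successors.\<close>
    have fa: "f a = 0"
      using eq[OF a] emp z by simp
    have succ_sum: "(\<Sum>c\<in>nb_succ G arev C b. f c) = (\<Sum>c\<in>nb_succ G arev ?B b. f c)"
      if b: "b \<in> C" "b \<noteq> a" for b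
    proof (rule sum.mono_neutral_right)
      show "finite (nb_succ G arev C b)"
        using fin by (simp add: nb_succ_def)
      show "nb_succ G arev ?B b \<subseteq> nb_succ G arev C b"
        by (auto simp: nb_succ_def)
      \<comment> \<open>Otherwise \<open>b\<close> would also end at the leaf, and
        \<open>arev b\<close> would be a successor of \<open>a\<close>.\<close>
      have "arev a \<notin> nb_succ G arev C b"
      proof
        assume "arev a \<in> nb_succ G arev C b"
        then have "head G b = head G a"
          using a sub by (auto simp: nb_succ_def)
        moreover have "arev b \<noteq> arev a"
          using b(2) by (metis arev_arev)
        ultimately have "arev b \<in> nb_succ G arev C a"
          using b(1) rev[OF b(1)] tail_arev[of b] sub by (simp add: nb_succ_def subset_iff)
        then show False
          using emp by simp
      qed
      then show "\<forall>c\<in>nb_succ G arev C b - nb_succ G arev ?B b. f c = 0"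
        using fa by (auto simp: nb_succ_def)
    qed
    \<comment> \<open>The value at \<open>arev a\<close> is determined by values on
      \<open>?B\<close>, so \<open>f\<close> cannot be supported on the removed edge alone and stays
      nonzero after pruning.\<close>
    have "f (arev a) = 0" if zero: "\<And>b. b \<in> ?B \<Longrightarrow> f b = 0"
    proof -
      have ra: "arev a \<in> C" "arev a \<noteq> a"
        using a rev sub arev_neq by auto
      have "z * f (arev a) = (\<Sum>c\<in>nb_succ G arev ?B (arev a). f c)"
        using eq[OF ra(1)] succ_sum[OF ra] by simp
      also have "\<dots> = 0"
        by (rule sum.neutral) (use zero in \<open>auto simp: nb_succ_def\<close>)
      finally show ?thesis
        using z by simp
    qed
    then have "\<exists>b\<in>?B. f b \<noteq> 0"
      using C fa by (auto simp: P_def nb_eigenfun_def)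
    moreover have "arev ` ?B \<subseteq> ?B"
    proof (rule image_subsetI)
      fix b
      assume "b \<in> ?B"
      moreover from this have "arev b \<noteq> a" "arev b \<noteq> arev a"
        by (metis arev_arev insertCI DiffD2)+
      ultimately show "arev b \<in> ?B"
        using rev by simp
    qed
    ultimately have "P ?B"
      using sub eq succ_sum by (auto simp: P_def nb_eigenfun_def)
    then have "card C \<le> card ?B"
      by (rule min)
    moreover have "card ?B < card C"
      using a fin by (intro psubset_card_mono) auto
    ultimately show False
      by simp
  qed
  then show ?thesis
    using C that by (auto simp: P_def)
qed

text \<open>The right side is the order \<open>k\<close> plus 1. One step of the equation would only
  give the bound \<open>2 * k + 1\<close>; two steps involve the degrees of two adjacent vertices,
  which share the total excess \<open>2 * k\<close>.\<close>

lemma nb_eigenfun_cmod_le_order: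
  assumes conn: "strongly_connected G"
    and loopless: "\<And>a. a \<in> arcs G \<Longrightarrow> head G a \<noteq> tail G a"
    and f: "nb_eigenfun G arev (arcs G) z f" and z: "z \<noteq> 0"
  shows "cmod z \<le> real (card (arcs G)) / 2 - real (card (verts G)) + 1"
proof -
  obtain C where C: "C \<subseteq> arcs G" "arev ` C \<subseteq> C" "nb_eigenfun G arev C z f"
    and succ: "\<And>a. a \<in> C \<Longrightarrow> nb_succ G arev C a \<noteq> {}"
    using nb_eigenfun_pruned[OF f z loopless] by metis
  define k where "k = real (card (arcs G)) / 2 - real (card (verts G))"
  define W where "W = tail G ` C"
  \<comment> \<open>Degrees are taken in the pruned graph, while \<open>k\<close> is the order of
    the whole graph.\<close>
  define deg where "deg v = card {a \<in> C. tail G a = v}" for v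
  have "finite C"
    using C(1) finite_arcs by (rule finite_subset)
  then have fin: "finite C" "finite W"
    by (simp_all add: W_def)
  have rev: "arev a \<in> C" if "a \<in> C" for a
    using C(2) that by auto
  have headW: "head G a \<in> W" if "a \<in> C" for a
    using that C(1) rev by (metis W_def image_eqI subsetD tail_arev)
  have card_succ: "real (card (nb_succ G arev C a)) = real (deg (head G a)) - 1" if a: "a \<in> C" for a
  proof -
    have "insert (arev a) (nb_succ G arev C a) = {b \<in> C. tail G b = head G a}"
      using a C(1) rev by (auto simp: nb_succ_def)
    moreover have "arev a \<notin> nb_succ G arev C a"
      by (simp add: nb_succ_def)
    moreover have "finite (nb_succ G arev C a)"
      using fin by (simp add: nb_succ_def)
    ultimately have "deg (head G a) = Suc (card (nb_succ G arev C a))"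
      unfolding deg_def by (metis card_insert_disjoint)
    then show ?thesis
      by simp
  qed
  have deg_ge: "real (deg v) \<ge> 2" if v: "v \<in> W" for v
  proof -
    obtain a where "a \<in> C" "v = tail G a"
      using v by (auto simp: W_def)
    \<comment> \<open>\<open>v\<close> is rewritten as the head of an arc because
      \<open>card_succ\<close> speaks of heads.\<close>
    then have a: "a \<in> C" "v = head G (arev a)"
      using C(1) by auto
    have "finite (nb_succ G arev C (arev a))"
      using fin by (simp add: nb_succ_def)
    then have "card (nb_succ G arev C (arev a)) \<ge> 1"
      using succ[OF rev[OF a(1)]] by (simp add: Suc_le_eq card_gt_0_iff)
    then show ?thesis
      using card_succ[OF rev[OF a(1)]] a(2) by simp
  qed
  have order: "real (card C) / 2 - real (card W) \<le> k"
  proof -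
    have W: "W \<subseteq> verts G" "W \<noteq> {}"
      using C by (auto simp: W_def nb_eigenfun_def)
    have "2 * card (verts G - W) \<le> card (arcs G - C)"
      using C W by (intro card_verts_diff_le conn) (auto simp: W_def)
    then have "real (2 * card (verts G - W)) \<le> real (card (arcs G - C))"
      by (simp only: of_nat_le_iff)
    moreover have "real (card (verts G - W)) = real (card (verts G)) - real (card W)"
      using W fin by (simp add: card_Diff_subset card_mono of_nat_diff)
    moreover have "real (card (arcs G - C)) = real (card (arcs G)) - real (card C)"
      using C fin by (simp add: card_Diff_subset card_mono of_nat_diff)
    ultimately show ?thesis
      by (simp add: k_def)
  qed
  \<comment> \<open>Grouping \<open>C\<close> by tails turns the sum into
    \<open>card C - 2 * card W\<close>.\<close>
  have deg_sum: "(\<Sum>v\<in>W. real (deg v) - 2) \<le> 2 * k"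
  proof -
    have "(\<Sum>v\<in>W. deg v) = card C"
      using sum_card_image[of W] sum.group[OF fin, of "tail G" "\<lambda>_. 1::nat"]
      by (simp add: W_def deg_def)
    then have "(\<Sum>v\<in>W. real (deg v)) = real (card C)"
      by (metis of_nat_sum)
    then show ?thesis
      using order by (simp add: sum_subtractf)
  qed
  have adj: "real (deg v) + real (deg w) \<le> 2 * k + 4" if "v \<in> W" "w \<in> W" "v \<noteq> w" for v w
  proof -
    have "(\<Sum>u\<in>{v, w}. real (deg u) - 2) \<le> (\<Sum>u\<in>W. real (deg u) - 2)"
      using that fin deg_ge by (intro sum_mono2) auto
    then show ?thesis
      using that deg_sum by simp
  qed
  obtain a0 where a0: "a0 \<in> C" "f a0 \<noteq> 0"
    using C by (auto simp: nb_eigenfun_def)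
  have "Max ((\<lambda>b. cmod (f b)) ` C) \<in> (\<lambda>b. cmod (f b)) ` C"
    using fin a0 by (intro Max_in) auto
  then obtain a where "a \<in> C" "Max ((\<lambda>b. cmod (f b)) ` C) = cmod (f a)"
    by auto
  then have a: "a \<in> C" "\<And>b. b \<in> C \<Longrightarrow> cmod (f b) \<le> cmod (f a)"
    using fin by (auto simp flip: \<open>_ = cmod (f a)\<close>)
  have fa: "cmod (f a) > 0"
    using a(2)[OF a0(1)] a0(2) by (smt (verit) zero_less_norm_iff)
  define x where "x = real (deg (head G a))"
  have eq: "cmod z * cmod (f b) = cmod (\<Sum>c\<in>nb_succ G arev C b. f c)" if "b \<in> C" for b
    using C(3) that by (metis nb_eigenfun_def norm_mult)
  \<comment> \<open>As there are no loops, \<open>b\<close> joins distinct vertices and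
    \<open>adj\<close> applies to its ends; \<open>x\<close> is the degree of the end shared with
    \<open>a\<close>.\<close>
  have step: "cmod z * cmod (f b) \<le> (2 * k + 3 - x) * cmod (f a)" if b: "b \<in> nb_succ G arev C a" for b
  proof -
    have bC: "b \<in> C" "tail G b = head G a"
      using b by (auto simp: nb_succ_def)
    have "real (deg (head G a)) + real (deg (head G b)) \<le> 2 * k + 4"
      using bC a(1) C(1) loopless[of b] by (intro adj headW) auto
    then have le: "real (card (nb_succ G arev C b)) \<le> 2 * k + 3 - x"
      using card_succ[OF bC(1)] by (simp add: x_def)
    have "cmod z * cmod (f b) \<le> real (card (nb_succ G arev C b)) * cmod (f a)"
      unfolding eq[OF bC(1)] using a by (intro sum_norm_bound) (auto simp: nb_succ_def)
    also have "\<dots> \<le> (2 * k + 3 - x) * cmod (f a)"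
      using le by (intro mult_right_mono) auto
    finally show ?thesis .
  qed
  have "cmod z ^ 2 * cmod (f a) = cmod z * cmod (\<Sum>b\<in>nb_succ G arev C a. f b)"
    by (simp add: power2_eq_square eq[OF a(1), symmetric])
  also have "\<dots> \<le> cmod z * (\<Sum>b\<in>nb_succ G arev C a. cmod (f b))"
    by (intro mult_left_mono norm_sum) auto
  also have "\<dots> = (\<Sum>b\<in>nb_succ G arev C a. cmod z * cmod (f b))"
    by (rule sum_distrib_left)
  also have "\<dots> \<le> of_nat (card (nb_succ G arev C a)) * ((2 * k + 3 - x) * cmod (f a))"
    by (rule sum_bounded_above) (rule step)
  also have "\<dots> = (x - 1) * (2 * k + 3 - x) * cmod (f a)"
    by (simp add: card_succ[OF a(1)] x_def)
  finally have "cmod z ^ 2 \<le> (x - 1) * (2 * k + 3 - x)"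
    using fa by (simp add: mult_le_cancel_right)
  \<comment> \<open>The two factors add up to \<open>2 * k + 2\<close>, so completing the square
    bounds their product as in the AM-GM inequality.\<close>
  also have "\<dots> = (k + 1)^2 - (x - k - 2)^2"
    by (simp add: power2_eq_square algebra_simps)
  also have "\<dots> \<le> (k + 1)^2"
    by simp
  finally have sq: "cmod z ^ 2 \<le> (k + 1)^2" .
  \<comment> \<open>A successor of \<open>a\<close> provides two adjacent vertices of degree at
    least 2. This forces \<open>k\<close> to be nonnegative, so that the root of \<open>sq\<close>
    may be taken.\<close>
  obtain b where b: "b \<in> nb_succ G arev C a"
    using succ[OF a(1)] by auto
  then have "real (deg (head G a)) + real (deg (head G b)) \<le> 2 * k + 4"
    using a(1) C(1) loopless[of b] by (intro adj headW) (auto simp: nb_succ_def)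
  moreover have "real (deg (head G a)) \<ge> 2" "real (deg (head G b)) \<ge> 2"
    using a(1) b deg_ge headW by (force simp: nb_succ_def)+
  ultimately have "0 \<le> k + 1"
    by simp
  with sq have "cmod z \<le> k + 1"
    by (rule power2_le_imp_le)
  then show ?thesis
    by (simp add: k_def)
qed

end

section \<open>Lower bound for supercritical tangles\<close>

lemma labelled_graph_fin_bidirected:
  "labelled_graph T \<Longrightarrow> fin_bidirected_digraph (dgraph T) (rev_arc T)"
  by (simp add: labelled_graph_def fin_bidirected_digraph_def bidirected_digraph_def)

lemma graph_order_eq:
  assumes "labelled_graph T"
  shows "real_of_int (graph_order T) =
    real (card (arcs (dgraph T))) / 2 - real (card (verts (dgraph T)))"
proof -
  interpret fin_bidirected_digraph "dgraph T" "rev_arc T"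
    by (rule labelled_graph_fin_bidirected) fact
  show ?thesis
    by (simp add: graph_order_def undirected_edges_def card_arcs)
qed

text \<open>A loop would be mapped to a fixed point of one of the matchings.\<close>

lemma tangle_loopless:
  assumes "tangle d T" and a: "a \<in> arcs (dgraph T)"
  shows "head (dgraph T) a \<noteq> tail (dgraph T) a"
proof -
  obtain n \<sigma> fv fe where \<sigma>: "\<forall>j\<in>{1..d}. \<sigma> j \<in> perfect_matchings n"
    and emb: "label_embedding T (matching_graph n d \<sigma>) fv fe"
    using assms(1) unfolding tangle_def model_graphs_def by blast
  obtain i j where ij: "fe a = (i, j)" "i \<in> {1..n}" "j \<in> {1..d}"
    using emb a by (fastforce simp: label_embedding_def matching_graph_def)
  have "\<sigma> j i = fv (head (dgraph T) a)" "i = fv (tail (dgraph T) a)"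
    using emb a ij by (auto simp: label_embedding_def matching_graph_def)
  moreover have "\<sigma> j i \<noteq> i"
    using \<sigma> ij by (auto simp: perfect_matchings_def)
  ultimately show ?thesis
    by auto
qed

lemma supercritical_tangle_order_ge:
  assumes "3 \<le> d" "tangle d T" "supercritical d T"
  shows "\<lceil>sqrt (real d - 1)\<rceil> - 1 \<le> graph_order T"
proof -
  have T: "labelled_graph T" "Digraph_Component.connected (dgraph T)"
    using assms(2) by (auto simp: tangle_def)
  interpret fin_bidirected_digraph "dgraph T" "rev_arc T"
    by (rule labelled_graph_fin_bidirected) fact
  obtain r vs where vs: "distinct vs" "set vs = arcs (dgraph T)"
    and r: "eigenvalue (adjacency_mat (irr_graph T) vs) (complex_of_real r)"
      "sqrt (real d - 1) \<le> r"
    using assms(3)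
    by (auto simp: supercritical_def perron_frobenius_eigenvalue_def irr_graph_def)
  \<comment> \<open>Pruning divides by the eigenvalue, so it must not vanish.\<close>
  have pos: "r > 0"
  proof -
    have "0 < sqrt (real d - 1)"
      using assms(1) by simp
    also note r(2)
    finally show ?thesis .
  qed
  obtain f where f: "nb_eigenfun (dgraph T) (rev_arc T) (arcs (dgraph T)) (complex_of_real r) f"
    using r(1) eigenvalue_irr_graph_iff[OF finite_arcs vs] by blast
  have "cmod (complex_of_real r) \<le>
      real (card (arcs (dgraph T))) / 2 - real (card (verts (dgraph T))) + 1"
  proof (rule nb_eigenfun_cmod_le_order[OF _ _ f])
    show "strongly_connected (dgraph T)"
      using symmetric T(2) by (rule symmetric_connected_imp_strongly_connected)
    show "head (dgraph T) a \<noteq> tail (dgraph T) a" if "a \<in> arcs (dgraph T)" for a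
      using assms(2) that by (rule tangle_loopless)
    show "complex_of_real r \<noteq> 0"
      using pos by simp
  qed
  then have "r \<le> real_of_int (graph_order T) + 1"
    using pos by (simp add: graph_order_eq[OF T(1)])
  with r(2) have "sqrt (real d - 1) \<le> real_of_int (graph_order T + 1)"
    by simp
  \<comment> \<open>The order is an integer, so the bound passes to the ceiling.\<close>
  then have "\<lceil>sqrt (real d - 1)\<rceil> \<le> graph_order T + 1"
    by (simp only: ceiling_le_iff)
  then show ?thesis
    by simp
qed

section \<open>The extremal graph: two vertices joined by parallel edges\<close>

definition swap12 :: "nat \<Rightarrow> nat" where
  "swap12 = Transposition.transpose 1 2"

text \<open>Taking the same matching for every label gives \<open>m\<close> parallel edges between 1
  and 2.\<close>

definition dipole :: "nat \<Rightarrow> (nat, nat \<times> nat) lgraph" where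
  "dipole m = matching_graph 2 m (\<lambda>_. swap12)"

lemma swap12_perfect_matching: "swap12 \<in> perfect_matchings 2"
proof -
  have "{1..2} = {1, 2::nat}"
    by auto
  then show ?thesis
    by (auto simp: perfect_matchings_def swap12_def intro!: permutes_swap_id)
qed

lemma dipole_simps [simp]:
  "verts (dgraph (dipole m)) = {1, 2}"
  "arcs (dgraph (dipole m)) = {1, 2} \<times> {1..m}"
  "tail (dgraph (dipole m)) = fst"
  "head (dgraph (dipole m)) = (\<lambda>(i, j). swap12 i)"
  "rev_arc (dipole m) = (\<lambda>(i, j). if (i, j) \<in> {1, 2} \<times> {1..m} then (swap12 i, j) else (i, j))"
  "arc_label (dipole m) = snd"
proof -
  have "{1..2} = {1, 2::nat}"
    by auto
  then show "verts (dgraph (dipole m)) = {1, 2}"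
    "arcs (dgraph (dipole m)) = {1, 2} \<times> {1..m}"
    "tail (dgraph (dipole m)) = fst"
    "head (dgraph (dipole m)) = (\<lambda>(i, j). swap12 i)"
    "rev_arc (dipole m) = (\<lambda>(i, j). if (i, j) \<in> {1, 2} \<times> {1..m} then (swap12 i, j) else (i, j))"
    "arc_label (dipole m) = snd"
    by (auto simp: dipole_def matching_graph_def)
qed

lemma swap12_simps [simp]: "swap12 1 = 2" "swap12 (Suc 0) = 2" "swap12 2 = 1"
  by (simp_all add: swap12_def)

lemma labelled_graph_dipole: "labelled_graph (dipole m)"
proof -
  have "fin_digraph (dgraph (dipole m))"
    by unfold_locales auto
  moreover have "bidirected_digraph (dgraph (dipole m)) (rev_arc (dipole m))"
    by unfold_locales (auto split: if_splits)
  ultimately show ?thesis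
    by (auto simp: labelled_graph_def)
qed

lemma connected_dipole:
  assumes "1 \<le> m"
  shows "Digraph_Component.connected (dgraph (dipole m))"
proof -
  let ?S = "mk_symmetric (dgraph (dipole m))"
  have e: "(1, 2) \<in> arcs_ends ?S" "(2, 1) \<in> arcs_ends ?S"
    using assms by (auto simp: mk_symmetric_def arcs_ends_conv intro!: bexI[of _ 1])
  have v: "verts ?S = {1, 2}"
    by (simp add: mk_symmetric_def)
  have "u \<rightarrow>\<^sup>*\<^bsub>?S\<^esub> w" if "u \<in> {1, 2}" "w \<in> {1, 2}" for u w
    using that e unfolding reachable_def v
    by (auto intro: rtrancl_on_into_rtrancl_on)
  then show ?thesis
    by (auto simp: connected_def strongly_connected_def v)
qed

text \<open>\<open>dipole d\<close> is itself an outcome of the model for \<open>n = 2\<close>, and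
  \<open>dipole m\<close> is its subgraph on the labels up to \<open>m\<close>.\<close>

lemma tangle_dipole:
  assumes "1 \<le> m" "m \<le> d"
  shows "tangle d (dipole m)"
proof -
  have "dipole d \<in> model_graphs 2 d"
    using swap12_perfect_matching by (auto simp: model_graphs_def dipole_def)
  moreover have "label_embedding (dipole m) (dipole d) id id"
    using assms by (auto simp: label_embedding_def)
  ultimately show ?thesis
    using assms unfolding tangle_def
    by (intro conjI labelled_graph_dipole connected_dipole exI[of _ 2]) (auto intro: even_numeral)
qed

text \<open>From each arc a non-backtracking walk may return along any of the \<open>m\<close> other
  edges, so the constant function is an eigenfunction for \<open>m\<close>, the common number of
  successors.\<close>

lemma perron_frobenius_dipole:
  "perron_frobenius_eigenvalue (irr_graph (dipole (Suc m))) (real m)"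
proof -
  let ?T = "dipole (Suc m)"
  let ?A = "arcs (dgraph ?T)" and ?S = "nb_succ (dgraph ?T) (rev_arc ?T) (arcs (dgraph ?T))"
  have fin: "finite ?A"
    by simp
  obtain vs where vs: "set vs = ?A" "distinct vs"
    using finite_distinct_list[OF fin] by auto
  have succ: "card (?S a) = m" if a: "a \<in> ?A" for a
  proof -
    obtain i j where ij: "a = (i, j)" "i \<in> {1, 2}" "j \<in> {1..Suc m}"
      using a by auto
    have "?S a = {swap12 i} \<times> ({1..Suc m} - {j})"
      using ij by (auto simp: nb_succ_def)
    then show ?thesis
      using ij by (simp add: card_cartesian_product)
  qed
  have "nb_eigenfun (dgraph ?T) (rev_arc ?T) ?A (of_nat m) (\<lambda>_. 1)"
    using succ unfolding nb_eigenfun_def by (auto simp del: dipole_simps) (auto intro!: exI[of _ 1])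
  moreover have "cmod z \<le> m" if "nb_eigenfun (dgraph ?T) (rev_arc ?T) ?A z f" for z f
    using that succ by (intro nb_eigenfun_cmod_le[OF fin]) auto
  ultimately have "eigenvalue (adjacency_mat (irr_graph ?T) vs) (complex_of_real (real m)) \<and>
      (\<forall>z. eigenvalue (adjacency_mat (irr_graph ?T) vs) z \<longrightarrow> cmod z \<le> real m)"
    using eigenvalue_irr_graph_iff[OF fin vs(2) vs(1)] by auto
  then show ?thesis
    unfolding perron_frobenius_eigenvalue_def
    using vs by (intro exI[of _ vs]) (simp add: irr_graph_def)
qed

section \<open>The minimum order\<close>

theorem theorem6p11:
  fixes d :: nat
  assumes "3 \<le> d"
  shows "(\<exists>T :: (nat, nat \<times> nat) lgraph.
            tangle d T \<and> supercritical d T \<and> graph_order T = \<lceil>sqrt (real d - 1)\<rceil> - 1) \<and>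
         (\<forall>T :: ('v, 'e) lgraph.
            tangle d T \<and> supercritical d T \<longrightarrow> \<lceil>sqrt (real d - 1)\<rceil> - 1 \<le> graph_order T)"
proof (rule conjI)
  define m where "m = nat \<lceil>sqrt (real d - 1)\<rceil>"
  have m: "\<lceil>sqrt (real d - 1)\<rceil> = int m"
  proof -
    have "0 \<le> sqrt (real d - 1)"
      using assms by simp
    then have "0 \<le> \<lceil>sqrt (real d - 1)\<rceil>"
      by linarith
    then show ?thesis
      by (simp add: m_def)
  qed
  \<comment> \<open>Ensures that \<open>d\<close> labels suffice for the \<open>m + 1\<close>
    parallel edges.\<close>
  have "sqrt (real d - 1) \<le> real d - 1"
    using assms by (intro real_le_lsqrt) (auto simp: power2_eq_square)
  then have "Suc m \<le> d"
    using assms m by linarith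
  then have "tangle d (dipole (Suc m))"
    by (simp add: tangle_dipole)
  moreover have "sqrt (real d - 1) \<le> real m"
    using m le_of_int_ceiling[of "sqrt (real d - 1)"] by simp
  then have "supercritical d (dipole (Suc m))"
    unfolding supercritical_def using perron_frobenius_dipole by blast
  \<comment> \<open>There are \<open>m + 1\<close> edges on two vertices.\<close>
  moreover have "real_of_int (graph_order (dipole (Suc m))) = real m - 1"
    by (simp add: graph_order_eq labelled_graph_dipole card_cartesian_product)
  then have "graph_order (dipole (Suc m)) = int m - 1"
    by linarith
  ultimately show "\<exists>T :: (nat, nat \<times> nat) lgraph.
      tangle d T \<and> supercritical d T \<and> graph_order T = \<lceil>sqrt (real d - 1)\<rceil> - 1"
    using m by auto
qed (use assms supercritical_tangle_order_ge in blast)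

end
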